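(* Let $d,m$ be positive integers, let $f:\mathbb{R}^d\to\mathbb{R}^d$ and $g_k:\mathbb{R}^d\to\mathbb{R}^d$, $k\in\{1,\dots,m\}$, be continuously differentiable, and let $\kappa=(\kappa_1,\dots,\kappa_m):\mathbb{R}^d\to\mathbb{R}^m$ be a feedback such that: (1) the nominal closed-loop system $\dot x(t)=f(x(t))+\sum_{k=1}^m g_k(x(t))\kappa_k(x(t))$ has a hyperbolic and locally asymptotically stable equilibrium at $0\in\mathbb{R}^d$; (2) the map $\xi\mapsto f(\xi)+\sum_{k=1}^m g_k(\xi)\kappa_k(\xi)$ is twice continuously differentiable in a neighborhood of $0$; (3) $f(0)=0$ and $\kappa_k(0)=0$ for each $k\in\{1,\dots,m\}$. Let $\mathcal{R}_{cl}\subset\mathbb{R}^d$ be the basin of attraction of the equilibrium $0$ of the nominal closed-loop system, let $V:\mathcal{R}_{cl}\to[0,+\infty[$ be the Lyapunov function described in the context, and for $\theta>0$ let $D_\theta=\{x\in\mathcal{R}_{cl}: V(x)\le\theta\}$. Fix $t_0\ge 0$ and $T>0$. For a switching-time function $\tau(\cdot)$ (as defined in the context) and $\bar x\in\mathbb{R}^d$ let $z(\cdot;\bar x,\hat\sigma(\cdot;\tau),t_0)$ denote the solution of $$\dot z(t)=f(z(t))+m\,g_{\hat\sigma(t-t_0;\tau)}(z(t))\,\kappa_{\hat\sigma(t-t_0;\tau)}(z(t)),\qquad z(t_0)=\bar x,\quad t\ge t_0,$$ where $$\hat\sigma(s;\tau)=1+\left\lfloor \frac{s-m\tau(s)\lfloor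 s/(m\tau(s))\rfloor}{\tau(s)}\right\rfloor\in\{1,\dots,m\},\qquad s\ge 0.$$ Then for every $\theta>0$ there exists a switching-time function $\tau'(\cdot;\theta)$ (depending on $\theta$) such that for any $\bar x\in D_\theta$ and any switching-time function $\tau$ that dominates $\tau'(\cdot;\theta)$, $$z(t;\bar x,\hat\sigma(\cdot;\tau),t_0)\to 0\quad\text{as } t\to+\infty .$$
   Context: An equilibrium point of a system with continuously differentiable vector field is hyperbolic if the Jacobian of the vector field at that point has no eigenvalue on the imaginary axis. The basin of attraction of an asymptotically stable equilibrium $0$ is the set of initial conditions whose trajectories converge to $0$ as $t\to+\infty$. Lyapunov function: $V:\mathcal{R}_{cl}\to[0,+\infty[$ is a fixed continuously differentiable positive definite function (provided by the converse Lyapunov theorem) such that $V(x)\to+\infty$ as $x$ tends to the boundary of $\mathcal{R}_{cl}$, and such that $V$ decreases strictly along the (nonzero) trajectories of the nominal closed-loop system, i.e. $\langle\nabla V(x),F(x)\rangle<0$ for $x\in\mathcal{R}_{cl}\setminus\{0\}$ with $F(x)=f(x)+\sum_{k=1}^m g_k(x)\kappa_k(x)$. For every $\theta>0$ the sublevel set $D_\theta$ is compact and invariant under the nominal closed-loop system. Switching-time function: with $T>0$ fixed, a piecewise constant non-increasing function $\tau:[0,+\infty[\,\to\,]0,+\infty[$ with $\tau(s)\to 0$ as $s\to+\infty$, which is constant on each interval $[(n-1)T,nT[$, $n\in\{1,2,\dots\}$; here $s=t-t_0$ is the time elapsed since $t_0$, so the switching time is held constant for $t\in[t_0+(n-1)T,\,t_0+nT[$.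 A switching-time function $\tau$ dominates another one $\tau'$ if $\tau(s)\le\tau'(s)$ for each $s$. Standing assumptions: for all systems considered (the nominal closed-loop system and the scheduled systems) the right-hand side is measurable in $t$ and locally Lipschitz in the state, and (Carathéodory) solutions are unique and exist for all $t\ge t_0$. *)

theory Defs
  imports "HOL-Analysis.Analysis"
begin

section \<open>Regularity of maps\<close>

definition C1_on :: "'a set \<Rightarrow> ('a::real_normed_vector \<Rightarrow> 'b::real_normed_vector) \<Rightarrow> bool" where
  "C1_on S f \<longleftrightarrow>
     (\<exists>f'. (\<forall>x\<in>S. (f has_derivative blinfun_apply (f' x)) (at x)) \<and> continuous_on S f')"

definition C2_on :: "'a set \<Rightarrow> ('a::real_normed_vector \<Rightarrow> 'b::real_normed_vector) \<Rightarrow> bool" where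
  "C2_on S f \<longleftrightarrow>
     (\<exists>f'. (\<forall>x\<in>S. (f has_derivative blinfun_apply (f' x)) (at x)) \<and> C1_on S f')"


section \<open>Solutions of time-varying systems\<close>

text \<open>A Caratheodory solution of \<open>z' = X t z\<close>, \<open>z t0 = x0\<close> on \<open>[t0, \<infinity>[\<close>, in integral form. This is
  the same as being locally absolutely continuous and satisfying the equation for almost every
  \<open>t\<close>. Values of \<open>z\<close> before \<open>t0\<close> are irrelevant.\<close>

definition caratheodory_solution ::
  "real \<Rightarrow> (real \<Rightarrow> 'a \<Rightarrow> 'a) \<Rightarrow> 'a \<Rightarrow> (real \<Rightarrow> 'a::euclidean_space) \<Rightarrow> bool" where
  "caratheodory_solution t0 X x0 z \<longleftrightarrow>
     (\<forall>t\<ge>t0. (\<lambda>s. X s (z s)) absolutely_integrable_on {t0..t} \<and>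
              z t = x0 + integral {t0..t} (\<lambda>s. X s (z s)))"

text \<open>The standing assumptions on every system considered.\<close>

definition well_posed :: "real \<Rightarrow> (real \<Rightarrow> 'a \<Rightarrow> 'a::euclidean_space) \<Rightarrow> bool" where
  "well_posed t0 X \<longleftrightarrow>
     (\<forall>x. (\<lambda>t. X t x) \<in> borel_measurable (lebesgue_on {t0..})) \<and>
     local_lipschitz {t0..} UNIV X \<and>
     (\<forall>x0. \<exists>z. caratheodory_solution t0 X x0 z) \<and>
     (\<forall>x0 z1 z2. caratheodory_solution t0 X x0 z1 \<and> caratheodory_solution t0 X x0 z2 \<longrightarrow>
        (\<forall>t\<ge>t0. z1 t = z2 t))"


section \<open>Autonomous systems\<close>

text \<open>Trajectories of an autonomous system are started at time 0, which is no restriction since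
  the system is invariant under time shifts.\<close>

abbreviation trajectory :: "('a \<Rightarrow> 'a) \<Rightarrow> 'a \<Rightarrow> (real \<Rightarrow> 'a::euclidean_space) \<Rightarrow> bool" where
  "trajectory F x0 z \<equiv> caratheodory_solution 0 (\<lambda>_. F) x0 z"

definition basin_of_attraction :: "('a \<Rightarrow> 'a::euclidean_space) \<Rightarrow> 'a set" where
  "basin_of_attraction F = {x0. \<exists>z. trajectory F x0 z \<and> (z \<longlongrightarrow> 0) at_top}"

text \<open>Local asymptotic stability of the equilibrium 0: Lyapunov stability and local attractivity.\<close>

definition locally_asymptotically_stable :: "('a \<Rightarrow> 'a::euclidean_space) \<Rightarrow> bool" where
  "locally_asymptotically_stable F \<longleftrightarrow>
     F 0 = 0 \<and>
     (\<forall>\<epsilon>>0. \<exists>\<delta>>0. \<forall>x0 z. norm x0 < \<delta> \<and> trajectory F x0 z \<longrightarrow> (\<forall>t\<ge>0. norm (z t) < \<epsilon>)) \<and>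
     (\<exists>\<delta>>0. \<forall>x0 z. norm x0 < \<delta> \<and> trajectory F x0 z \<longrightarrow> (z \<longlongrightarrow> 0) at_top)"

definition matrix_eigenvalue :: "'a::field ^ 'n ^ 'n \<Rightarrow> 'a \<Rightarrow> bool" where
  "matrix_eigenvalue A \<mu> \<longleftrightarrow> (\<exists>v. v \<noteq> 0 \<and> A *v v = \<mu> *s v)"

definition hyperbolic_equilibrium :: "(real ^ 'd \<Rightarrow> real ^ 'd) \<Rightarrow> real ^ 'd \<Rightarrow> bool" where
  "hyperbolic_equilibrium F x \<longleftrightarrow>
     F x = 0 \<and> F differentiable (at x) \<and>
     (\<forall>\<mu>. matrix_eigenvalue (map_matrix complex_of_real (jacobian F (at x))) \<mu> \<longrightarrow> Re \<mu> \<noteq> 0)"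

text \<open>\<open>V\<close> is only meaningful on the basin \<open>R\<close>. Compactness of the sublevel sets amounts to
  \<open>V(x) \<rightarrow> \<infinity>\<close> at the boundary of \<open>R\<close> and, when \<open>R\<close> is unbounded, also at infinity.\<close>

definition sublevel :: "'a set \<Rightarrow> ('a \<Rightarrow> real) \<Rightarrow> real \<Rightarrow> 'a set" where
  "sublevel R V \<theta> = {x \<in> R. V x \<le> \<theta>}"

definition lyapunov_function ::
  "('a \<Rightarrow> 'a) \<Rightarrow> 'a set \<Rightarrow> ('a::euclidean_space \<Rightarrow> real) \<Rightarrow> bool" where
  "lyapunov_function F R V \<longleftrightarrow>
     V 0 = 0 \<and> (\<forall>x\<in>R - {0}. V x > 0) \<and>
     (\<exists>G. (\<forall>x\<in>R. GDERIV V x :> G x) \<and> continuous_on R G \<and>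
          (\<forall>x\<in>R - {0}. inner (G x) (F x) < 0)) \<and>
     (\<forall>b\<in>frontier R. filterlim V at_top (at b within R)) \<and>
     (\<forall>\<theta>>0. compact (sublevel R V \<theta>))"


section \<open>Scheduled systems\<close>

text \<open>The input channels are indexed by \<open>{1..m}\<close>; \<open>g k\<close> and \<open>\<kappa> k\<close> are irrelevant for other \<open>k\<close>.\<close>

definition nominal_field ::
  "nat \<Rightarrow> ('a \<Rightarrow> 'a) \<Rightarrow> (nat \<Rightarrow> 'a \<Rightarrow> 'a) \<Rightarrow> (nat \<Rightarrow> 'a \<Rightarrow> real) \<Rightarrow> 'a \<Rightarrow> 'a::euclidean_space" where
  "nominal_field m f g \<kappa> x = f x + (\<Sum>k=1..m. \<kappa> k x *\<^sub>R g k x)"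

definition switching_time_function :: "real \<Rightarrow> (real \<Rightarrow> real) \<Rightarrow> bool" where
  "switching_time_function T \<tau> \<longleftrightarrow>
     (\<forall>s\<ge>0. \<tau> s > 0) \<and> antimono_on {0..} \<tau> \<and> (\<tau> \<longlongrightarrow> 0) at_top \<and>
     (\<forall>n\<ge>1. \<tau> constant_on {(real n - 1) * T..<real n * T})"

definition dominates :: "(real \<Rightarrow> real) \<Rightarrow> (real \<Rightarrow> real) \<Rightarrow> bool" where
  "dominates \<tau> \<tau>' \<longleftrightarrow> (\<forall>s\<ge>0. \<tau> s \<le> \<tau>' s)"

definition schedule :: "nat \<Rightarrow> (real \<Rightarrow> real) \<Rightarrow> real \<Rightarrow> nat" where
  "schedule m \<tau> s =
     1 + nat \<lfloor>(s - real m * \<tau> s * of_int \<lfloor>s / (real m * \<tau> s)\<rfloor>) / \<tau> s\<rfloor>"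

definition scheduled_field ::
  "nat \<Rightarrow> ('a \<Rightarrow> 'a) \<Rightarrow> (nat \<Rightarrow> 'a \<Rightarrow> 'a) \<Rightarrow> (nat \<Rightarrow> 'a \<Rightarrow> real) \<Rightarrow> real \<Rightarrow> (real \<Rightarrow> real) \<Rightarrow>
     real \<Rightarrow> 'a \<Rightarrow> 'a::euclidean_space" where
  "scheduled_field m f g \<kappa> t0 \<tau> t x =
     (let k = schedule m \<tau> (t - t0) in f x + (real m * \<kappa> k x) *\<^sub>R g k x)"

end

theory Submission
  imports Defs
begin

text \<open>Write \<open>h k = f + m \<kappa>\<^sub>k g\<^sub>k\<close>, so that \<open>F\<close> is the average of the \<open>h k\<close>. Over one full switching cycle of
  length \<open>m p\<close> the state moves by \<open>m p F\<close> up to an error that is \<open>o(p)\<close> uniformly on compact sublevel sets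
  of \<open>V\<close>. Hence for each \<open>\<epsilon>\<close> there are \<open>\<delta>\<close> and \<open>\<gamma>\<close> such that a window of length \<open>T\<close> with switching time
  at most \<open>\<delta>\<close> takes \<open>V\<close> from \<open>v\<close> to at most \<open>max (v - \<gamma>) \<epsilon>\<close>. Let \<open>\<epsilon>\<^sub>j\<close> tend to 0 and let \<open>\<tau>'\<close> be at most
  \<open>\<delta>\<^sub>0, \<dots>, \<delta>\<^sub>n\<close> on the \<open>n\<close>-th window: then, for every \<open>j\<close>, all windows but finitely many have the above
  property with \<open>\<epsilon>\<^sub>j\<close>, and \<open>V\<close> tends to 0 along the trajectory.\<close>

section \<open>Uniform estimates near compact sets\<close>

text \<open>A Lebesgue number of the cover of \<open>K\<close> by open subsets of \<open>R\<close>
  on which \<open>f\<close> oscillates by less than \<open>\<eta>\<close> serves as radius. Unlike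
  in uniform continuity on \<open>K\<close>, the second point may leave \<open>K\<close>. The form
  with \<open>at_right 0\<close> lets finitely many such radii be merged.\<close>

lemma compact_uniform_continuity_near:
  fixes f :: "'a::metric_space \<Rightarrow> 'b::metric_space"
  assumes "compact K" "open R" "K \<subseteq> R" "continuous_on R f" "\<eta> > 0"
  shows "\<forall>\<^sub>F \<rho> in at_right 0. \<forall>x\<in>K. \<forall>y. dist x y \<le> \<rho> \<longrightarrow> y \<in> R \<and> dist (f x) (f y) < \<eta>"
proof -
  define \<G> where "\<G> = {U. open U \<and> U \<subseteq> R \<and> (\<forall>x\<in>U. \<forall>y\<in>U. dist (f x) (f y) < \<eta>)}"
  have "x \<in> \<Union>\<G>" if "x \<in> K" for x
  proof -
    have "x \<in> R" using that assms by auto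
    have op: "open (f -` ball (f x) (\<eta>/2) \<inter> R)"
      using assms by (metis continuous_on_open_vimage open_ball)
    have "dist (f u) (f v) < \<eta>" if "u \<in> f -` ball (f x) (\<eta>/2)" "v \<in> f -` ball (f x) (\<eta>/2)" for u v
      using that dist_triangle_half_r[of "f x" "f u" \<eta> "f v"] by simp
    then have "f -` ball (f x) (\<eta>/2) \<inter> R \<in> \<G>"
      unfolding \<G>_def using op by blast
    moreover have "x \<in> f -` ball (f x) (\<eta>/2) \<inter> R" using \<open>x \<in> R\<close> \<open>\<eta> > 0\<close> by simp
    ultimately show ?thesis by (rule UnionI)
  qed
  then have "K \<subseteq> \<Union>\<G>" by (rule subsetI)
  then obtain e where e: "0 < e" "\<forall>x\<in>K. \<exists>G\<in>\<G>. ball x e \<subseteq> G"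
    using Heine_Borel_lemma[OF \<open>compact K\<close>, of \<G>] unfolding \<G>_def by (metis (no_types, lifting) mem_Collect_eq)
  have "\<forall>x\<in>K. \<forall>y. dist x y \<le> \<rho> \<longrightarrow> y \<in> R \<and> dist (f x) (f y) < \<eta>" if "\<rho> < e" "0 < \<rho>" for \<rho>
  proof safe
    fix x y assume "x \<in> K" "dist x y \<le> \<rho>"
    obtain G where "G \<in> \<G>" "ball x e \<subseteq> G" using e \<open>x \<in> K\<close> by auto
    moreover have "x \<in> ball x e" "y \<in> ball x e" using that \<open>dist x y \<le> \<rho>\<close> by auto
    ultimately show "y \<in> R" "dist (f x) (f y) < \<eta>" unfolding \<G>_def by blast+
  qed
  then show ?thesis
    unfolding eventually_at_right_field using \<open>e > 0\<close> by blast
qed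

text \<open>This is the one-dimensional mean value theorem along the segment from \<open>x\<close>
  to \<open>y\<close>, which stays in the ball by convexity.\<close>

lemma gderiv_mean_value:
  fixes V :: "'a::real_inner \<Rightarrow> real"
  assumes "\<And>y. y \<in> cball x \<rho> \<Longrightarrow> GDERIV V y :> G y" "y \<in> cball x \<rho>"
  obtains \<xi> where "\<xi> \<in> cball x \<rho>" "V y - V x = G \<xi> \<bullet> (y - x)"
proof -
  have in_ball: "x + s *\<^sub>R (y - x) \<in> cball x \<rho>" if "0 \<le> s" "s \<le> 1" for s
  proof -
    have "s * norm (y - x) \<le> 1 * norm (y - x)" using that by (intro mult_right_mono) auto
    then show ?thesis using that assms(2) by (auto simp: dist_norm norm_minus_commute)
  qed
  have "\<exists>s\<in>{0..1}. V (x + 1 *\<^sub>R (y - x)) - V (x + 0 *\<^sub>R (y - x))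
      = (1 - 0) *\<^sub>R (y - x) \<bullet> G (x + s *\<^sub>R (y - x))"
  proof (rule mvt_very_simple)
    fix s :: real assume s: "0 \<le> s" "s \<le> 1"
    have "FDERIV V (x + s *\<^sub>R (y - x)) :> (\<lambda>h. h \<bullet> G (x + s *\<^sub>R (y - x)))"
      using assms(1)[OF in_ball[OF s]] by (simp add: gderiv_def)
    moreover have "((\<lambda>s. x + s *\<^sub>R (y - x)) has_derivative (\<lambda>h. h *\<^sub>R (y - x))) (at s within {0..1})"
      by (auto intro!: derivative_eq_intros)
    ultimately show "((\<lambda>s. V (x + s *\<^sub>R (y - x))) has_derivative
       (\<lambda>h. h *\<^sub>R (y - x) \<bullet> G (x + s *\<^sub>R (y - x)))) (at s within {0..1})"
      by (rule has_derivative_compose[rotated])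
  qed simp
  then obtain s where "s \<in> {0..1}" "V y - V x = G (x + s *\<^sub>R (y - x)) \<bullet> (y - x)"
    by (auto simp: inner_commute)
  then show thesis using in_ball that[of "x + s *\<^sub>R (y - x)"] by auto
qed

section \<open>Switching cycles\<close>

text \<open>The inner floor counts the \<open>i\<close> complete cycles before \<open>s\<close>, the
  outer one the \<open>k - 1\<close> complete slots of length \<open>p\<close> within the current
  cycle.\<close>

lemma schedule_eq:
  fixes i :: nat and p s :: real
  assumes "p > 0" "\<tau> s = p" "1 \<le> k" "k \<le> m"
    and "i * (m * p) + (real k - 1) * p \<le> s" "s < i * (m * p) + k * p"
  shows "schedule m \<tau> s = k"
proof -
  have mp: "real m * p > 0" using assms by auto
  have "0 \<le> (real k - 1) * p" "k * p \<le> m * p" using assms by auto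
  then have "i * (m * p) \<le> s" "s < (real i + 1) * (m * p)"
    using assms(5,6) unfolding distrib_right by linarith+
  then have "real i \<le> s / (m * p)" "s / (m * p) < real i + 1"
    using mp by (simp_all only: pos_le_divide_eq pos_divide_less_eq)
  then have fl: "\<lfloor>s / (m * p)\<rfloor> = int i" by (simp add: floor_eq_iff)
  have "(s - m * p * i) / p < k" "real k - 1 \<le> (s - m * p * i) / p"
    using assms by (auto simp: field_simps)
  then have "\<lfloor>(s - m * p * i) / p\<rfloor> = int k - 1" by (simp add: floor_eq_iff)
  then show ?thesis using fl assms by (simp add: schedule_def)
qed

lemma schedule_range:
  assumes "\<tau> s > 0" "m \<ge> 1"
  shows "schedule m \<tau> s \<in> {1..m}"
proof -
  define i where "i = \<lfloor>s / (m * \<tau> s)\<rfloor>"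
  have mp: "real m * \<tau> s > 0" using assms by auto
  have "of_int i \<le> s / (m * \<tau> s)" "s / (m * \<tau> s) < of_int i + 1" by (auto simp: i_def)
  then have "0 \<le> (s - m * \<tau> s * i) / \<tau> s" "(s - m * \<tau> s * i) / \<tau> s < m"
    using mp assms by (auto simp: field_simps)
  then have "0 \<le> \<lfloor>(s - m * \<tau> s * i) / \<tau> s\<rfloor>" "\<lfloor>(s - m * \<tau> s * i) / \<tau> s\<rfloor> < int m"
    by (auto simp: floor_less_iff)
  then show ?thesis using assms(2) by (auto simp: schedule_def i_def)
qed

text \<open>Initial time and initial value are forgotten, so that a solution can be restricted to
  windows, cycles and parts of cycles. Integrability is contained in
  \<open>has_integral\<close>.\<close>

definition driven_by ::
  "(nat \<Rightarrow> 'a \<Rightarrow> 'a::euclidean_space) \<Rightarrow> (real \<Rightarrow> nat) \<Rightarrow> real \<Rightarrow> real \<Rightarrow> (real \<Rightarrow> 'a) \<Rightarrow> bool" where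
  "driven_by h \<sigma> a b z \<longleftrightarrow> (\<forall>s t. a \<le> s \<and> s \<le> t \<and> t \<le> b \<longrightarrow>
     ((\<lambda>u. h (\<sigma> u) (z u)) has_integral z t - z s) {s..t})"

lemma driven_by_subset: "driven_by h \<sigma> a b z \<Longrightarrow> a \<le> c \<Longrightarrow> d \<le> b \<Longrightarrow> driven_by h \<sigma> c d z"
  unfolding driven_by_def by auto

lemma caratheodory_increment:
  assumes "caratheodory_solution t0 X x0 z" "t0 \<le> s" "s \<le> t"
  shows "((\<lambda>u. X u (z u)) has_integral z t - z s) {s..t}"
proof -
  let ?f = "\<lambda>u. X u (z u)"
  have int: "?f integrable_on {t0..t}"
    using assms by (auto simp: caratheodory_solution_def intro: set_lebesgue_integral_eq_integral)
  have "integral {t0..s} ?f + integral {s..t} ?f = integral {t0..t} ?f"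
    using assms int by (intro Henstock_Kurzweil_Integration.integral_combine) auto
  then have "z t - z s = integral {s..t} ?f"
    using assms by (auto simp: caratheodory_solution_def algebra_simps)
  moreover have "?f integrable_on {s..t}"
    using int assms by (auto intro: integrable_subinterval_real)
  ultimately show ?thesis by (simp add: has_integral_integral)
qed

lemma continuous_on_if_increments:
  fixes z :: "real \<Rightarrow> 'a::euclidean_space"
  assumes "\<And>t. a \<le> t \<Longrightarrow> t \<le> b \<Longrightarrow> (w has_integral z t - z a) {a..t}"
  shows "continuous_on {a..b} z"
proof (cases "a \<le> b")
  case True
  then have "w integrable_on {a..b}" using assms by blast
  then have "continuous_on {a..b} (\<lambda>t. z a + integral {a..t} w)"
    by (intro continuous_intros indefinite_integral_continuous_1)
  then show ?thesis
    by (rule continuous_on_eq) (use integral_unique[OF assms] in auto)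
qed simp

text \<open>The speed bound \<open>M\<close> is known only inside the ball, so the argument is a
  bootstrap: until the ball is left, the distance travelled is at most
  \<open>M * (b - a) < \<rho>\<close>, which leaves no first time at distance
  \<open>\<rho>\<close>.\<close>

lemma driven_by_stays:
  assumes z: "driven_by h \<sigma> a b z" and \<sigma>: "\<And>u. u \<in> {a..b} \<Longrightarrow> \<sigma> u \<in> I"
    and h: "\<And>k y. k \<in> I \<Longrightarrow> y \<in> cball (z a) \<rho> \<Longrightarrow> norm (h k y) \<le> M"
    and M: "M * (b - a) < \<rho>" "0 \<le> M" and t: "t \<in> {a..b}"
  shows "dist (z a) (z t) \<le> M * (t - a)" "z t \<in> cball (z a) \<rho>"
proof -
  have grow: "dist (z a) (z t) \<le> M * (t - a)"
    if t: "t \<in> {a..b}" and s: "\<And>s. a \<le> s \<Longrightarrow> s < t \<Longrightarrow> dist (z a) (z s) \<le> \<rho>" for t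
  proof -
    have "((\<lambda>u. h (\<sigma> u) (z u)) has_integral z t - z a) {a..t}"
      using z t by (auto simp: driven_by_def)
    \<comment> \<open>The premise on \<open>z\<close> covers only times before \<open>t\<close>; the
      time \<open>t\<close> itself is discarded as a null set.\<close>
    then have "norm (z t - z a) \<le> M * measure lborel {a..t}"
      by (rule has_integral_bound_real[rotated 2, where S="{t}"]) (use h s \<sigma> t M in auto)
    then show ?thesis using t by (auto simp: dist_norm norm_minus_commute)
  qed
  have cont: "continuous_on {a..b} (\<lambda>t. dist (z a) (z t))"
    using z by (intro continuous_intros continuous_on_if_increments) (auto simp: driven_by_def)
  have near: "dist (z a) (z t) \<le> \<rho>" if t: "t \<in> {a..b}" for t
  proof (rule ccontr)
    assume far: "\<not> dist (z a) (z t) \<le> \<rho>"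
    \<comment> \<open>The infimum of \<open>A\<close> is the first time at distance at least
      \<open>\<rho>\<close>. It is attained because \<open>A\<close> is closed, and
      \<open>grow\<close> applies to it.\<close>
    define A where "A = {a..b} \<inter> (\<lambda>t. dist (z a) (z t)) -` {\<rho>..}"
    have "closed A" unfolding A_def by (intro continuous_closed_preimage cont) auto
    moreover have "t \<in> A" using far t by (auto simp: A_def)
    moreover have bdd: "bdd_below A" by (auto simp: A_def)
    ultimately have inf: "Inf A \<in> A" by (intro closed_contains_Inf) auto
    have "dist (z a) (z s) \<le> \<rho>" if "a \<le> s" "s < Inf A" for s
    proof -
      have "s \<notin> A" using that bdd cInf_lower[of s A] by auto
      then show ?thesis using that inf by (auto simp: A_def)
    qed
    then have "dist (z a) (z (Inf A)) \<le> M * (Inf A - a)"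
      using inf by (intro grow) (auto simp: A_def)
    also have "\<dots> \<le> M * (b - a)" using inf M by (intro mult_left_mono) (auto simp: A_def)
    finally show False using inf M by (auto simp: A_def)
  qed
  show "dist (z a) (z t) \<le> M * (t - a)" using near t by (intro grow) auto
  show "z t \<in> cball (z a) \<rho>" using near t by auto
qed

section \<open>Displacement and descent over one cycle\<close>

lemma cycle_integral:
  fixes y :: "nat \<Rightarrow> 'a::euclidean_space"
  assumes "p > 0"
    and \<sigma>: "\<And>k u. 1 \<le> k \<Longrightarrow> k \<le> m \<Longrightarrow> c + (real k - 1) * p \<le> u \<Longrightarrow> u < c + k * p \<Longrightarrow> \<sigma> u = k"
  shows "((\<lambda>u. y (\<sigma> u)) has_integral p *\<^sub>R (\<Sum>k=1..m. y k)) {c..c + m * p}"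
  using \<sigma>
proof (induction m)
  case (Suc m)
  have "((\<lambda>u. y (Suc m)) has_integral (c + Suc m * p - (c + m * p)) *\<^sub>R y (Suc m))
      {c + m * p..c + Suc m * p}"
    by (rule has_integral_const_real[THEN has_integral_eq_rhs]) (use \<open>p > 0\<close> in \<open>auto simp: algebra_simps\<close>)
  \<comment> \<open>The right endpoint is outside the half-open slot, so \<open>\<sigma>\<close> is
    unknown there; a single point does not affect the integral.\<close>
  then have "((\<lambda>u. y (\<sigma> u)) has_integral (c + Suc m * p - (c + m * p)) *\<^sub>R y (Suc m))
      {c + m * p..c + Suc m * p}"
  proof (rule has_integral_spike_finite[rotated 2])
    fix u assume "u \<in> {c + m * p..c + Suc m * p} - {c + Suc m * p}"
    then have "\<sigma> u = Suc m" by (intro Suc.prems) auto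
    then show "y (\<sigma> u) = y (Suc m)" by simp
  qed simp
  then have "((\<lambda>u. y (\<sigma> u)) has_integral
      p *\<^sub>R (\<Sum>k=1..m. y k) + (c + Suc m * p - (c + m * p)) *\<^sub>R y (Suc m)) {c..c + Suc m * p}"
    using Suc \<open>p > 0\<close> by (intro has_integral_combine[where c="c + m * p"]) auto
  then show ?case by (simp add: algebra_simps)
qed (use has_integral_refl(2)[of _ c] in simp)

text \<open>With the state frozen at \<open>z c\<close>, a cycle moves it by exactly
  \<open>p\<close> times the sum of the \<open>h k\<close>. The true displacement differs from this
  by at most \<open>\<eta> * (m * p)\<close>, which costs a term with factor \<open>B\<close> when
  paired with the gradient. Moving the gradient from the mean value point back to \<open>z c\<close>
  costs the term with factor \<open>M\<close>.\<close>

lemma cycle_descent: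
  fixes h :: "nat \<Rightarrow> 'a::euclidean_space \<Rightarrow> 'a"
  assumes z: "driven_by h \<sigma> c (c + m * p) z" and p: "p > 0"
    and \<sigma>: "\<And>k u. 1 \<le> k \<Longrightarrow> k \<le> m \<Longrightarrow> c + (real k - 1) * p \<le> u \<Longrightarrow> u < c + k * p \<Longrightarrow> \<sigma> u = k"
    and \<sigma>m: "\<And>u. u \<in> {c..c + m * p} \<Longrightarrow> \<sigma> u \<in> {1..m}"
    and h: "\<And>k y. k \<in> {1..m} \<Longrightarrow> y \<in> cball (z c) \<rho> \<Longrightarrow> norm (h k y) \<le> M"
      "\<And>k y. k \<in> {1..m} \<Longrightarrow> y \<in> cball (z c) \<rho> \<Longrightarrow> dist (h k (z c)) (h k y) \<le> \<eta>"
    and M: "M * (m * p) < \<rho>" "0 \<le> M" and "0 \<le> \<eta>"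
    and V: "\<And>y. y \<in> cball (z c) \<rho> \<Longrightarrow> GDERIV V y :> G y"
    and G: "\<And>y. y \<in> cball (z c) \<rho> \<Longrightarrow> dist (G (z c)) (G y) \<le> \<eta>" "norm (G (z c)) \<le> B"
  shows "V (z (c + m * p)) - V (z c) \<le> p * (G (z c) \<bullet> (\<Sum>k=1..m. h k (z c))) + m * p * (B + M) * \<eta>"
proof -
  let ?x = "z c" and ?y = "z (c + m * p)"
  let ?S = "\<Sum>k=1..m. h k ?x"
  have mp: "0 \<le> m * p" using p by auto
  have y: "dist ?x ?y \<le> M * (m * p)" "?y \<in> cball ?x \<rho>"
    using driven_by_stays[OF z \<sigma>m h(1), where t="c + m * p"] M mp by auto
  have near: "z t \<in> cball ?x \<rho>" if "t \<in> {c..c + m * p}" for t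
    using driven_by_stays(2)[OF z \<sigma>m h(1) _ _ that] M mp by auto
  have int0: "((\<lambda>u. h (\<sigma> u) ?x) has_integral p *\<^sub>R ?S) {c..c + m * p}"
    by (rule cycle_integral[OF p \<sigma>])
  have "((\<lambda>u. h (\<sigma> u) (z u) - h (\<sigma> u) ?x) has_integral (?y - ?x) - p *\<^sub>R ?S) {c..c + m * p}"
    using z mp by (intro has_integral_diff int0) (auto simp: driven_by_def)
  then have "norm ((?y - ?x) - p *\<^sub>R ?S) \<le> \<eta> * measure lborel {c..c + m * p}"
    by (rule has_integral_bound_real[rotated 2, where S="{}"])
      (use \<open>0 \<le> \<eta>\<close> h(2)[OF \<sigma>m near] in \<open>auto simp: dist_norm norm_minus_commute\<close>)
  then have drift: "norm ((?y - ?x) - p *\<^sub>R ?S) \<le> \<eta> * (m * p)" using mp by simp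
  obtain \<xi> where \<xi>: "\<xi> \<in> cball ?x \<rho>" "V ?y - V ?x = G \<xi> \<bullet> (?y - ?x)"
    using gderiv_mean_value[OF V y(2)] by blast
  have "V ?y - V ?x = p * (G ?x \<bullet> ?S) + G ?x \<bullet> ((?y - ?x) - p *\<^sub>R ?S) + (G \<xi> - G ?x) \<bullet> (?y - ?x)"
    using \<xi> by (simp add: inner_diff_left inner_diff_right algebra_simps)
  moreover have "G ?x \<bullet> ((?y - ?x) - p *\<^sub>R ?S) \<le> B * (\<eta> * (m * p))"
  proof -
    have "norm (G ?x) * norm ((?y - ?x) - p *\<^sub>R ?S) \<le> B * (\<eta> * (m * p))"
      using drift G(2) by (intro mult_mono) (auto intro: order_trans[OF norm_ge_zero])
    then show ?thesis using norm_cauchy_schwarz order_trans by blast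
  qed
  moreover have "(G \<xi> - G ?x) \<bullet> (?y - ?x) \<le> \<eta> * (M * (m * p))"
  proof -
    have "norm (G \<xi> - G ?x) * norm (?y - ?x) \<le> \<eta> * (M * (m * p))"
      using y(1) G(1)[OF \<xi>(1)] \<open>0 \<le> \<eta>\<close>
      by (intro mult_mono) (auto simp: dist_norm norm_minus_commute)
    then show ?thesis using norm_cauchy_schwarz order_trans by blast
  qed
  ultimately show ?thesis by (simp add: algebra_simps)
qed


section \<open>Decrease of the Lyapunov function over a window\<close>

text \<open>Each estimate holds for all small radii and there are finitely many maps, so a common
  radius exists.\<close>

lemma uniform_moduli:
  fixes h :: "nat \<Rightarrow> 'a::euclidean_space \<Rightarrow> 'a"
  assumes "compact K" "open R" "K \<subseteq> R" "continuous_on R V" "continuous_on R G"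
    and h: "\<And>k. k \<in> {1..m} \<Longrightarrow> continuous_on R (h k)" and "(\<eta>::real) > 0"
  obtains \<rho> :: real where "\<rho> > 0"
    "\<And>x y. x \<in> K \<Longrightarrow> y \<in> cball x \<rho> \<Longrightarrow> y \<in> R"
    "\<And>x y. x \<in> K \<Longrightarrow> y \<in> cball x \<rho> \<Longrightarrow> dist (V x) (V y) < \<eta>"
    "\<And>x y. x \<in> K \<Longrightarrow> y \<in> cball x \<rho> \<Longrightarrow> dist (G x) (G y) < \<eta>"
    "\<And>x y k. x \<in> K \<Longrightarrow> y \<in> cball x \<rho> \<Longrightarrow> k \<in> {1..m} \<Longrightarrow> dist (h k x) (h k y) < \<eta>"
proof -
  note near = compact_uniform_continuity_near[OF assms(1-3) _ \<open>\<eta> > 0\<close>]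
  have "\<forall>\<^sub>F \<rho> in at_right 0. \<forall>k\<in>{1..m}. \<forall>x\<in>K. \<forall>y. dist x y \<le> \<rho> \<longrightarrow> y \<in> R \<and> dist (h k x) (h k y) < \<eta>"
    by (intro eventually_ball_finite ballI near h) auto
  with near[OF assms(4)] near[OF assms(5)] eventually_at_right_less[of 0]
  have "\<forall>\<^sub>F \<rho> in at_right 0. 0 < \<rho> \<and>
      (\<forall>x\<in>K. \<forall>y. dist x y \<le> \<rho> \<longrightarrow> y \<in> R \<and> dist (V x) (V y) < \<eta>) \<and>
      (\<forall>x\<in>K. \<forall>y. dist x y \<le> \<rho> \<longrightarrow> y \<in> R \<and> dist (G x) (G y) < \<eta>) \<and>
      (\<forall>k\<in>{1..m}. \<forall>x\<in>K. \<forall>y. dist x y \<le> \<rho> \<longrightarrow> y \<in> R \<and> dist (h k x) (h k y) < \<eta>)"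
    by eventually_elim blast
  from eventually_happens'[OF trivial_limit_at_right_real this] obtain \<rho> where "0 < \<rho> \<and>
      (\<forall>x\<in>K. \<forall>y. dist x y \<le> \<rho> \<longrightarrow> y \<in> R \<and> dist (V x) (V y) < \<eta>) \<and>
      (\<forall>x\<in>K. \<forall>y. dist x y \<le> \<rho> \<longrightarrow> y \<in> R \<and> dist (G x) (G y) < \<eta>) \<and>
      (\<forall>k\<in>{1..m}. \<forall>x\<in>K. \<forall>y. dist x y \<le> \<rho> \<longrightarrow> y \<in> R \<and> dist (h k x) (h k y) < \<eta>)" by blast
  then show thesis by (intro that[of \<rho>]) auto
qed

text \<open>Cycles are aligned to \<open>t0\<close>, so a window may begin and end with an incomplete cycle, over each of
  which \<open>V\<close> may grow by \<open>\<eta>\<close>. The complete cycles fill at least half of the window and outweigh this growth.\<close>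

lemma window_iterate:
  fixes h :: "nat \<Rightarrow> 'a::euclidean_space \<Rightarrow> 'a"
  assumes m: "m \<ge> 1" and p: "p > 0" and T: "T > 0" "4 * (m * p) \<le> T" and "t0 \<le> a"
    and z: "driven_by h \<sigma> a (a + T) z"
    and \<sigma>: "\<And>u. u \<in> {a..a+T} \<Longrightarrow> \<sigma> u \<in> {1..m}"
      "\<And>u. u \<in> {a..<a+T} \<Longrightarrow> \<sigma> u = schedule m (\<lambda>_. p) (u - t0)"
    and near: "\<And>x y. x \<in> sublevel R V (\<theta> + 1) \<Longrightarrow> y \<in> cball x \<rho> \<Longrightarrow> y \<in> R \<and> V y \<le> V x + \<eta> \<and>
        GDERIV V y :> G y \<and> dist (G x) (G y) \<le> \<eta> \<and> (\<forall>k\<in>{1..m}. dist (h k x) (h k y) \<le> \<eta> \<and> norm (h k y) \<le> M)"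
    and M: "M * (m * p) < \<rho>" "0 \<le> M"
    and B: "\<And>x. x \<in> sublevel R V (\<theta> + 1) \<Longrightarrow> norm (G x) \<le> B"
    and c: "\<And>x. x \<in> sublevel R V (\<theta> + 1) \<Longrightarrow> V x \<ge> \<epsilon> / 2 \<Longrightarrow> G x \<bullet> (\<Sum>k=1..m. h k x) \<le> - c" "c > 0"
    and \<eta>: "\<eta> > 0" "\<eta> \<le> \<epsilon> / 4" "2 * m * (B + M) * \<eta> \<le> c" "16 * m * \<eta> \<le> T * c"
    and \<epsilon>: "\<epsilon> \<le> 1" "\<theta> > 0"
    and a: "z a \<in> sublevel R V \<theta>"
  shows "\<And>t. t \<in> {a..a+T} \<Longrightarrow> z t \<in> R \<and> V (z t) \<le> max (V (z a)) \<epsilon> + \<epsilon>"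
    and "V (z (a + T)) \<le> max (V (z a) - T * c / (8 * m)) \<epsilon>"
proof -
  define L where "L = m * p"
  have L: "0 < L" "4 * L \<le> T" "M * L < \<rho>" using m p T M by (auto simp: L_def)
  let ?K = "sublevel R V (\<theta> + 1)"
  \<comment> \<open>Within one cycle length the state travels less than \<open>\<rho>\<close>,
    because \<open>M * L < \<rho>\<close>, and in that ball \<open>V\<close> grows by at most
    \<open>\<eta>\<close>.\<close>
  have step: "z t \<in> R \<and> V (z t) \<le> V (z s) + \<eta>"
    if "z s \<in> ?K" "a \<le> s" "s \<le> t" "t \<le> s + L" "t \<le> a + T" for s t
  proof -
    have "M * (t - s) \<le> M * L" using that M by (intro mult_left_mono) auto
    then have "z t \<in> cball (z s) \<rho>"
      using that near[OF that(1)] \<sigma>(1) M L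
      by (intro driven_by_stays(2)[where \<sigma>=\<sigma> and b=t and I="{1..m}" and h=h] driven_by_subset[OF z]) auto
    then show ?thesis using near[OF that(1)] by blast
  qed
  \<comment> \<open>If \<open>V\<close> is at least \<open>\<epsilon> / 2\<close>, the descent
    \<open>p * c\<close> is at least twice the averaging error. Below \<open>\<epsilon> / 2\<close>,
    growth by \<open>\<eta> \<le> \<epsilon> / 4\<close> cannot pass
    \<open>3 * \<epsilon> / 4\<close>. The gap from there to \<open>\<epsilon>\<close> is reserved
    for the incomplete cycle at the end of the window.\<close>
  have cycle: "z (s + L) \<in> R \<and> V (z (s + L)) \<le> max (V (z s) - p * c / 2) (3 * \<epsilon> / 4)"
    if K: "z s \<in> ?K" and s: "a \<le> s" "s + L \<le> a + T" "s = t0 + real i * L" for s i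
  proof (cases "V (z s) \<ge> \<epsilon> / 2")
    case True
    have sched: "\<sigma> u = k" if "1 \<le> k" "k \<le> m" "s + (real k - 1) * p \<le> u" "u < s + k * p" for k u
    proof -
      have "0 \<le> (real k - 1) * p" "k * p \<le> L" using that p by (auto simp: L_def)
      then have "\<sigma> u = schedule m (\<lambda>_. p) (u - t0)" using s that by (intro \<sigma>) auto
      also have "\<dots> = k" using that p s by (intro schedule_eq[where i=i and p=p]) (auto simp: L_def)
      finally show ?thesis .
    qed
    have "V (z (s + m * p)) - V (z s)
        \<le> p * (G (z s) \<bullet> (\<Sum>k=1..m. h k (z s))) + m * p * (B + M) * \<eta>"
      using p s M B[OF K] \<eta> near[OF K] \<sigma>(1)
      by (intro cycle_descent[where \<sigma>=\<sigma> and \<rho>=\<rho>] driven_by_subset[OF z] sched) (auto simp: L_def)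
    moreover have "p * (G (z s) \<bullet> (\<Sum>k=1..m. h k (z s))) \<le> p * (- c)"
      using c(1)[OF K True] p by (intro mult_left_mono) auto
    moreover have "p * (2 * m * (B + M) * \<eta>) \<le> p * c" using \<eta> p by (intro mult_left_mono) auto
    ultimately have "V (z (s + L)) \<le> V (z s) - p * c / 2" by (simp add: L_def algebra_simps)
    then show ?thesis using step[OF K, of "s + L"] s L by auto
  next
    case False
    then show ?thesis using step[OF K, of "s + L"] s L \<eta> by auto
  qed
  \<comment> \<open>The index \<open>i0\<close> is that of the first cycle boundary at or after
    \<open>a\<close>; the \<open>s n\<close> are the boundaries from there on.\<close>
  define i0 where "i0 = nat \<lceil>(a - t0) / L\<rceil>"
  define s where "s n = t0 + real (i0 + n) * L" for n
  have "0 \<le> \<lceil>(a - t0) / L\<rceil>" using \<open>t0 \<le> a\<close> L by (simp add: less_le_trans[of "-1" 0])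
  then have "real i0 = of_int \<lceil>(a - t0) / L\<rceil>" by (simp add: i0_def)
  then have "(a - t0) / L \<le> i0" "i0 < (a - t0) / L + 1" by linarith+
  then have s0: "a \<le> s 0" "s 0 < a + L" using L by (auto simp: s_def field_simps)
  have s_eq: "s n = s 0 + n * L" for n by (simp add: s_def algebra_simps)
  have s_ge: "a \<le> s n" for n using s0 L s_eq[of n] by (simp add: add_increasing2)
  have aK: "z a \<in> ?K" using a by (auto simp: sublevel_def)
  \<comment> \<open>The slack 1 in \<open>\<theta> + 1\<close> absorbs the growth
    \<open>\<eta>\<close> over the incomplete first cycle, so the estimates on \<open>?K\<close>
    stay applicable throughout the iteration.\<close>
  have inK: "z u \<in> ?K" if "z u \<in> R" "V (z u) \<le> max (V (z a) + \<eta> - r) (3 * \<epsilon> / 4)" "0 \<le> r" for u r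
    using that a \<eta> \<epsilon> by (auto simp: sublevel_def)
  have iter: "z (s n) \<in> R \<and> V (z (s n)) \<le> max (V (z a) + \<eta> - n * (p * c / 2)) (3 * \<epsilon> / 4)"
    if "s n \<le> a + T" for n
    using that
  proof (induction n)
    case 0
    show ?case using step[OF aK, of "s 0"] s0 0 by auto
  next
    case (Suc n)
    have suc: "s (Suc n) = s n + L" by (simp add: s_def algebra_simps)
    then have IH: "z (s n) \<in> R" "V (z (s n)) \<le> max (V (z a) + \<eta> - n * (p * c / 2)) (3 * \<epsilon> / 4)"
      using Suc L by auto
    have pc: "0 \<le> p * c / 2" using p c by auto
    have "z (s n) \<in> ?K" using IH pc by (intro inK[where r="n * (p * c / 2)"]) auto
    then have "z (s n + L) \<in> R \<and> V (z (s n + L)) \<le> max (V (z (s n)) - p * c / 2) (3 * \<epsilon> / 4)"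
      using Suc.prems suc s_ge by (intro cycle[where i="i0 + n"]) (auto simp: s_def)
    moreover have "real (Suc n) * (p * c / 2) = n * (p * c / 2) + p * c / 2" by (simp add: algebra_simps)
    moreover define d where "d = p * c / 2"
    ultimately show ?case using IH(2) pc unfolding suc d_def[symmetric] by linarith
  qed
  have last: "\<exists>n. s n \<le> t \<and> t < s n + L" if "s 0 \<le> t" for t
  proof -
    define n where "n = nat \<lfloor>(t - s 0) / L\<rfloor>"
    have "real n = of_int \<lfloor>(t - s 0) / L\<rfloor>" using that L by (auto simp: n_def)
    then have "n \<le> (t - s 0) / L" "(t - s 0) / L < n + 1" by linarith+
    then show ?thesis using L unfolding s_eq[of n] by (intro exI[of _ n]) (auto simp: s_eq[of n] field_simps)
  qed
  have from_s: "z t \<in> R \<and> V (z t) \<le> max (V (z a) + \<eta> - n * (p * c / 2)) (3 * \<epsilon> / 4) + \<eta>"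
    if "s n \<le> t" "t < s n + L" "t \<le> a + T" for t n
  proof -
    have it: "z (s n) \<in> R" "V (z (s n)) \<le> max (V (z a) + \<eta> - n * (p * c / 2)) (3 * \<epsilon> / 4)"
      using iter[of n] that by auto
    then have "z (s n) \<in> ?K" using p c by (intro inK[where r="n * (p * c / 2)"]) auto
    then show ?thesis using step[of "s n" t] that s_ge[of n] it by auto
  qed
  show "z t \<in> R \<and> V (z t) \<le> max (V (z a)) \<epsilon> + \<epsilon>" if t: "t \<in> {a..a+T}" for t
  proof (cases "t < s 0")
    case True
    then show ?thesis using step[OF aK, of t] t s0 \<eta> by auto
  next
    case False
    then obtain n where n: "s n \<le> t" "t < s n + L" using last[of t] by auto
    have "0 \<le> n * (p * c / 2)" using p c by auto
    then show ?thesis using from_s[OF n] t \<eta> by auto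
  qed
  obtain n where n: "s n \<le> a + T" "a + T < s n + L" using last[of "a + T"] s0 L by auto
  \<comment> \<open>The incomplete cycles at both ends take less than
    \<open>2 * L \<le> T / 2\<close>. The complete ones therefore provide a descent of at least
    \<open>T * c / (4 * m)\<close>, half of which pays for the two growths by
    \<open>\<eta>\<close>.\<close>
  have "T / 2 \<le> n * L" using n s0 L s_eq[of n] by auto
  then have "T / 2 * c \<le> n * L * c" using c by (intro mult_right_mono) auto
  then have "T * c / (4 * m) \<le> n * (p * c / 2)" using m by (auto simp: L_def field_simps)
  moreover have "2 * \<eta> \<le> T * c / (8 * m)" using m \<eta> by (auto simp: field_simps)
  moreover have "T * c / (4 * m) = 2 * (T * c / (8 * m))" by simp
  ultimately show "V (z (a + T)) \<le> max (V (z a) - T * c / (8 * m)) \<epsilon>"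
    using from_s[OF n] \<eta> by auto
qed

text \<open>The constants are fixed in order: \<open>M\<close>, \<open>B\<close> and
  \<open>c\<close> by compactness, \<open>\<eta>\<close> from these, \<open>\<rho>\<close> from
  \<open>\<eta>\<close>, and \<open>\<delta>\<close> from \<open>\<rho>\<close>. None of them
  depends on the solution, the schedule or the position of the window, so one pair
  \<open>\<delta>\<close>, \<open>\<gamma>\<close> serves all windows.\<close>

lemma window_decrease:
  fixes h :: "nat \<Rightarrow> 'a::euclidean_space \<Rightarrow> 'a"
  assumes m: "m \<ge> 1" and R: "open R" and V: "\<And>x. x \<in> R \<Longrightarrow> GDERIV V x :> G x"
    and G: "continuous_on R G" and h: "\<And>k. k \<in> {1..m} \<Longrightarrow> continuous_on R (h k)"
    and decr: "\<And>x. x \<in> R \<Longrightarrow> V x > 0 \<Longrightarrow> G x \<bullet> (\<Sum>k=1..m. h k x) < 0"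
    and K: "compact (sublevel R V (\<theta> + 1))"
    and pos: "0 < \<epsilon>" "\<epsilon> \<le> 1" "\<theta> > 0" "T > 0"
  shows "\<exists>\<delta>>0. \<exists>\<gamma>>0. \<forall>p \<sigma> a t0 z. 0 < p \<and> p \<le> \<delta> \<and> t0 \<le> a \<and> driven_by h \<sigma> a (a + T) z \<and>
      (\<forall>u\<in>{a..a+T}. \<sigma> u \<in> {1..m}) \<and> (\<forall>u\<in>{a..<a+T}. \<sigma> u = schedule m (\<lambda>_. p) (u - t0)) \<and>
      z a \<in> sublevel R V \<theta> \<longrightarrow>
      (\<forall>t\<in>{a..a+T}. z t \<in> R \<and> V (z t) \<le> max (V (z a)) \<epsilon> + \<epsilon>) \<and>
      V (z (a + T)) \<le> max (V (z a) - \<gamma>) \<epsilon>"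
proof -
  let ?K = "sublevel R V (\<theta> + 1)"
  have KR: "?K \<subseteq> R" by (auto simp: sublevel_def)
  have contV: "continuous_on R V"
    using V by (auto simp: gderiv_def intro!: has_derivative_continuous continuous_at_imp_continuous_on)
  have "bounded (h k ` ?K)" if "k \<in> {1..m}" for k
    using K continuous_on_subset[OF h[OF that] KR]
    by (intro compact_imp_bounded compact_continuous_image)
  then have "bounded (\<Union>k\<in>{1..m}. h k ` ?K)" by (intro bounded_UN) auto
  then obtain M where M: "M > 0" "\<And>k x. k \<in> {1..m} \<Longrightarrow> x \<in> ?K \<Longrightarrow> norm (h k x) \<le> M"
    unfolding bounded_pos by blast
  have "bounded (G ` ?K)"
    using K continuous_on_subset[OF G KR] by (intro compact_imp_bounded compact_continuous_image)
  then obtain B where B: "B > 0" "\<And>x. x \<in> ?K \<Longrightarrow> norm (G x) \<le> B"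
    unfolding bounded_pos by blast
  define \<phi> where "\<phi> x = G x \<bullet> (\<Sum>k=1..m. h k x)" for x
  \<comment> \<open>Strict decrease becomes uniform where \<open>V\<close> is at least
    \<open>\<epsilon> / 2\<close>: on this compact part of \<open>?K\<close> the maximum of
    \<open>\<phi>\<close> is negative. If the part is empty, the default 1 is taken.\<close>
  obtain c where c: "c > 0" "\<And>x. x \<in> ?K \<Longrightarrow> V x \<ge> \<epsilon> / 2 \<Longrightarrow> \<phi> x \<le> - c"
  proof -
    let ?A = "?K \<inter> (?K \<inter> V -` {\<epsilon>/2..})"
    have "closed (?K \<inter> V -` {\<epsilon>/2..})"
      using compact_imp_closed[OF K] continuous_on_subset[OF contV KR]
      by (intro continuous_closed_preimage) auto
    then have "compact ?A" using K by (rule compact_Int_closed[rotated])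
    moreover have "continuous_on ?A \<phi>"
      unfolding \<phi>_def using G h KR by (intro continuous_intros) (auto intro: continuous_on_subset)
    ultimately show thesis
    proof (cases "?A = {}")
      case True
      then show thesis using that[of 1] by fastforce
    next
      case False
      obtain x0 where x0: "x0 \<in> ?A" "\<And>x. x \<in> ?A \<Longrightarrow> \<phi> x \<le> \<phi> x0"
        using continuous_attains_sup[OF \<open>compact ?A\<close> False \<open>continuous_on ?A \<phi>\<close>] by blast
      then have "\<phi> x0 < 0" unfolding \<phi>_def using pos KR by (intro decr) auto
      then show thesis using that[of "- \<phi> x0"] x0 by auto
    qed
  qed
  \<comment> \<open>The entry 1 makes \<open>M + 1\<close> a bound for the fields on balls around
    points of \<open>?K\<close>. The second limits growth when \<open>V\<close> is small, the third
    keeps the averaging error below half the descent, and the last bounds the growth over the two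
    incomplete cycles.\<close>
  define \<eta> where "\<eta> = Min {1, \<epsilon> / 4, c / (2 * m * (B + (M + 1))), T * c / (16 * m)}"
  have pos1: "0 < c / (2 * m * (B + (M + 1)))" "0 < T * c / (16 * m)"
    using m B M c pos by (auto intro!: divide_pos_pos mult_pos_pos)
  have "0 < \<eta>" using pos pos1 by (simp add: \<eta>_def)
  moreover have "\<eta> \<le> u" if "u \<in> {1, \<epsilon> / 4, c / (2 * m * (B + (M + 1))), T * c / (16 * m)}" for u
    unfolding \<eta>_def using that by (intro Min_le) auto
  ultimately have \<eta>: "0 < \<eta>" "\<eta> \<le> 1" "\<eta> \<le> \<epsilon> / 4" "\<eta> \<le> c / (2 * m * (B + (M + 1)))" "\<eta> \<le> T * c / (16 * m)"
    by blast+
  obtain \<rho> :: real where \<rho>: "\<rho> > 0"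
    "\<And>x y. x \<in> ?K \<Longrightarrow> y \<in> cball x \<rho> \<Longrightarrow> y \<in> R"
    "\<And>x y. x \<in> ?K \<Longrightarrow> y \<in> cball x \<rho> \<Longrightarrow> dist (V x) (V y) < \<eta>"
    "\<And>x y. x \<in> ?K \<Longrightarrow> y \<in> cball x \<rho> \<Longrightarrow> dist (G x) (G y) < \<eta>"
    "\<And>x y k. x \<in> ?K \<Longrightarrow> y \<in> cball x \<rho> \<Longrightarrow> k \<in> {1..m} \<Longrightarrow> dist (h k x) (h k y) < \<eta>"
    using uniform_moduli[OF K R KR contV G, where m=m and h=h and \<eta>=\<eta>] h \<eta>(1) by blast
  have near: "y \<in> R \<and> V y \<le> V x + \<eta> \<and> GDERIV V y :> G y \<and> dist (G x) (G y) \<le> \<eta> \<and>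
      (\<forall>k\<in>{1..m}. dist (h k x) (h k y) \<le> \<eta> \<and> norm (h k y) \<le> M + 1)"
    if xy: "x \<in> ?K" "y \<in> cball x \<rho>" for x y
  proof (intro conjI ballI)
    show "y \<in> R" by (rule \<rho>(2)[OF xy])
    then show "GDERIV V y :> G y" by (rule V)
    show "V y \<le> V x + \<eta>" using \<rho>(3)[OF xy] by (simp add: dist_real_def)
    show "dist (G x) (G y) \<le> \<eta>" using \<rho>(4)[OF xy] by simp
    fix k assume k: "k \<in> {1..m}"
    show "dist (h k x) (h k y) \<le> \<eta>" using \<rho>(5)[OF xy k] by simp
    then show "norm (h k y) \<le> M + 1"
      using M(2)[OF k xy(1)] \<eta>(2) norm_triangle_sub[of "h k y" "h k x"]
      by (simp add: dist_norm norm_minus_commute)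
  qed
  \<comment> \<open>The first bound keeps the distance travelled in one cycle below
    \<open>\<rho>\<close>; the second makes a window at least four cycles long.\<close>
  define \<delta> where "\<delta> = min (\<rho> / (2 * (M + 1) * m)) (T / (4 * m))"
  have "0 < \<delta>" using \<rho>(1) M m pos by (auto simp: \<delta>_def)
  have "0 < T * c / (8 * m)" using pos m c by auto
  have main: "(\<forall>t\<in>{a..a+T}. z t \<in> R \<and> V (z t) \<le> max (V (z a)) \<epsilon> + \<epsilon>) \<and>
      V (z (a + T)) \<le> max (V (z a) - T * c / (8 * m)) \<epsilon>"
    if p: "0 < p" "p \<le> \<delta>" and t0: "t0 \<le> a" and z: "driven_by h \<sigma> a (a + T) z"
      and \<sigma>: "\<forall>u\<in>{a..a+T}. \<sigma> u \<in> {1..m}" "\<forall>u\<in>{a..<a+T}. \<sigma> u = schedule m (\<lambda>_. p) (u - t0)"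
      and a: "z a \<in> sublevel R V \<theta>" for p \<sigma> a t0 z
  proof -
    have "p \<le> \<rho> / (2 * (M + 1) * m)" "p \<le> T / (4 * m)" using p by (auto simp: \<delta>_def)
    then have "2 * ((M + 1) * (m * p)) \<le> \<rho>" and T4: "4 * (m * p) \<le> T"
      using m M by (auto simp: pos_le_divide_eq mult_ac)
    then have Mp: "(M + 1) * (m * p) < \<rho>" using \<rho>(1) by linarith
    have \<eta>': "2 * m * (B + (M + 1)) * \<eta> \<le> c" "16 * m * \<eta> \<le> T * c"
      using \<eta>(4,5) m M B by (auto simp: pos_le_divide_eq mult_ac)
    note it = window_iterate[where R=R and V=V and \<theta>=\<theta> and G=G and \<rho>=\<rho> and M="M + 1" and B=B,
        OF m p(1) pos(4) T4 t0 z \<sigma>(1)[rule_format] \<sigma>(2)[rule_format] near Mp _ B(2)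
          c(2)[unfolded \<phi>_def] c(1) \<eta>(1,3) \<eta>' pos(2,3) a]
    show ?thesis using it M(1) by auto
  qed
  show ?thesis
    by (rule exI[of _ \<delta>], rule conjI[OF \<open>0 < \<delta>\<close>], rule exI[of _ "T * c / (8 * m)"],
        rule conjI[OF \<open>0 < T * c / (8 * m)\<close>], intro allI impI, elim conjE, rule main)
qed


section \<open>Convergence\<close>

lemma switching_time_function_of_seq:
  fixes p :: "nat \<Rightarrow> real"
  assumes "T > 0" "\<And>n. p n > 0" "antimono p" "p \<longlonglongrightarrow> 0"
  shows "switching_time_function T (\<lambda>s. p (nat \<lfloor>s / T\<rfloor>))"
  unfolding switching_time_function_def
proof (intro conjI allI impI)
  show "antimono_on {0..} (\<lambda>s. p (nat \<lfloor>s / T\<rfloor>))"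
  proof (rule monotone_onI)
    fix s t :: real assume "s \<le> t"
    then have "s / T \<le> t / T" using \<open>T > 0\<close> by (intro divide_right_mono) auto
    then show "p (nat \<lfloor>s / T\<rfloor>) \<ge> p (nat \<lfloor>t / T\<rfloor>)"
      by (intro antimonoD[OF assms(3)] nat_mono floor_mono)
  qed
  have "filterlim (\<lambda>s. s / T) at_top at_top"
    using \<open>T > 0\<close> filterlim_tendsto_pos_mult_at_top[OF tendsto_const[of "1 / T"] _ filterlim_ident]
    by (simp add: field_simps)
  then have "filterlim (\<lambda>s. nat \<lfloor>s / T\<rfloor>) sequentially at_top"
    by (intro filterlim_compose[OF filterlim_nat_sequentially]
        filterlim_compose[OF filterlim_floor_sequentially])
  then show "((\<lambda>s. p (nat \<lfloor>s / T\<rfloor>)) \<longlongrightarrow> 0) at_top"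
    by (rule filterlim_compose[OF assms(4)])
  fix n :: nat assume "1 \<le> n"
  \<comment> \<open>Switching-time functions number their windows from 1, the sequence from
    0.\<close>
  have "p (nat \<lfloor>s / T\<rfloor>) = p (n - 1)" if "s \<in> {(real n - 1) * T..<real n * T}" for s
  proof -
    have "real n - 1 \<le> s / T" "s / T < n" using that \<open>T > 0\<close> by (auto simp: field_simps)
    then have "\<lfloor>s / T\<rfloor> = int (n - 1)" using \<open>1 \<le> n\<close> by (simp add: floor_eq_iff of_nat_diff)
    then show ?thesis by simp
  qed
  then show "(\<lambda>s. p (nat \<lfloor>s / T\<rfloor>)) constant_on {(real n - 1) * T..<real n * T}"
    unfolding constant_on_def by blast
qed (use assms in auto)

text \<open>Above \<open>\<epsilon>\<close> each step costs at least \<open>\<gamma>\<close>, which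
  cannot go on forever; a value at most \<open>\<epsilon>\<close> is followed only by such
  values.\<close>

lemma eventually_le_if_decrease:
  fixes v :: "nat \<Rightarrow> real"
  assumes "\<gamma> > 0" and v: "\<And>n. n \<ge> N \<Longrightarrow> v (Suc n) \<le> max (v n - \<gamma>) \<epsilon>"
  shows "eventually (\<lambda>n. v n \<le> \<epsilon>) sequentially"
proof -
  have "\<exists>n\<ge>N. v n \<le> \<epsilon>"
  proof (rule ccontr)
    assume none: "\<not> (\<exists>n\<ge>N. v n \<le> \<epsilon>)"
    have "v (N + k) \<le> v N - k * \<gamma>" for k
    proof (induction k)
      case (Suc k)
      have "v (Suc (N + k)) \<le> max (v (N + k) - \<gamma>) \<epsilon>" by (intro v) simp
      moreover have "\<not> v (Suc (N + k)) \<le> \<epsilon>" using none by simp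
      ultimately show ?case using Suc by (auto simp: algebra_simps)
    qed simp
    moreover obtain k :: nat where "v N - \<epsilon> < k * \<gamma>" using reals_Archimedean3[OF \<open>\<gamma> > 0\<close>] by blast
    moreover have "\<not> v (N + k) \<le> \<epsilon>" using none by simp
    ultimately show False by (smt (verit))
  qed
  then obtain n where n: "n \<ge> N" "v n \<le> \<epsilon>" by blast
  have "v k \<le> \<epsilon>" if "k \<ge> n" for k
    using that
  proof (induction k rule: dec_induct)
    case (step k)
    then show ?case using v[of k] n \<open>\<gamma> > 0\<close> by auto
  qed (use n in auto)
  then show ?thesis unfolding eventually_sequentially by blast
qed

text \<open>On the part of the compact sublevel set outside a ball around 0, \<open>V\<close> has a
  positive minimum, so a small value of \<open>V\<close> forces the point into the ball.\<close>

lemma tendsto_zero_if_lyapunov: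
  fixes z :: "'b \<Rightarrow> 'a::real_normed_vector"
  assumes K: "compact (sublevel R V 1)" and "continuous_on R V"
    and pos: "\<And>x. x \<in> R \<Longrightarrow> x \<noteq> 0 \<Longrightarrow> V x > 0"
    and V: "\<And>e. e > 0 \<Longrightarrow> eventually (\<lambda>t. z t \<in> R \<and> V (z t) < e) F"
  shows "(z \<longlongrightarrow> 0) F"
proof (rule tendstoI)
  fix r :: real assume "r > 0"
  let ?A = "sublevel R V 1 \<inter> - ball 0 r"
  have "compact ?A" using K by (intro compact_Int_closed) auto
  moreover have "continuous_on ?A V"
    by (rule continuous_on_subset[OF assms(2)]) (auto simp: sublevel_def)
  ultimately obtain e where e: "e > 0" "\<And>x. x \<in> ?A \<Longrightarrow> e \<le> V x"
  proof (cases "?A = {}")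
    case True
    then show thesis using that[of 1] by auto
  next
    case False
    obtain x where x: "x \<in> ?A" "\<And>y. y \<in> ?A \<Longrightarrow> V x \<le> V y"
      using continuous_attains_inf[OF \<open>compact ?A\<close> False \<open>continuous_on ?A V\<close>] by blast
    then have "V x > 0" using \<open>r > 0\<close> by (intro pos) (auto simp: sublevel_def)
    then show thesis using that x by blast
  qed
  have "eventually (\<lambda>t. z t \<in> R \<and> V (z t) < min e 1) F" using e by (intro V) auto
  then show "eventually (\<lambda>t. dist (z t) 0 < r) F"
  proof eventually_elim
    case (elim t)
    then show ?case using e(2)[of "z t"] by (force simp: sublevel_def)
  qed
qed

text \<open>Window \<open>n\<close> may use the tolerance \<open>\<epsilon> j\<close> as soon as
  \<open>j \<le> n\<close>. The tolerance \<open>\<epsilon> 0\<close> is available from the start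
  and keeps the state in the sublevel set of \<open>\<theta>\<close> at all window ends; each later
  one eventually brings \<open>V\<close> down to at most \<open>2 * \<epsilon> j\<close>.\<close>

lemma scheduled_convergence:
  fixes h :: "nat \<Rightarrow> 'a::euclidean_space \<Rightarrow> 'a"
  assumes m: "m \<ge> 1" and R: "open R" and V: "\<And>x. x \<in> R \<Longrightarrow> GDERIV V x :> G x"
    and G: "continuous_on R G" and h: "\<And>k. k \<in> {1..m} \<Longrightarrow> continuous_on R (h k)"
    and V0: "V 0 = 0" "\<And>x. x \<in> R \<Longrightarrow> x \<noteq> 0 \<Longrightarrow> V x > 0"
    and decr: "\<And>x. x \<in> R \<Longrightarrow> x \<noteq> 0 \<Longrightarrow> G x \<bullet> (\<Sum>k=1..m. h k x) < 0"
    and K: "\<And>\<theta>. \<theta> > 0 \<Longrightarrow> compact (sublevel R V \<theta>)"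
    and T: "T > 0" and \<theta>: "\<theta> > 0"
  shows "\<exists>\<tau>'. switching_time_function T \<tau>' \<and>
           (\<forall>x\<in>sublevel R V \<theta>. \<forall>\<tau>. switching_time_function T \<tau> \<and> dominates \<tau> \<tau>' \<longrightarrow>
              (\<forall>z. caratheodory_solution t0 (\<lambda>t. h (schedule m \<tau> (t - t0))) x z \<longrightarrow>
                   (z \<longlongrightarrow> 0) at_top))"
proof -
  \<comment> \<open>The bound 1 is required by the window estimate; the bound
    \<open>\<theta>\<close> ensures that no window ends outside the sublevel set.\<close>
  define \<epsilon> where "\<epsilon> j = min 1 \<theta> / (real j + 1)" for j :: nat
  have \<epsilon>: "0 < \<epsilon> j" "\<epsilon> j \<le> 1" for j
    using \<theta> by (auto simp: \<epsilon>_def divide_le_eq min_def)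
  have contV: "continuous_on R V"
    using V by (auto simp: gderiv_def intro!: has_derivative_continuous continuous_at_imp_continuous_on)
  have decr': "G x \<bullet> (\<Sum>k=1..m. h k x) < 0" if "x \<in> R" "V x > 0" for x
    using that V0(1) by (intro decr) auto
  have "compact (sublevel R V (\<theta> + 1))" using \<theta> by (intro K) auto
  note window = window_decrease[OF m R V G h decr' this \<epsilon> \<theta> T]
  define Q where "Q j \<delta> \<gamma> \<longleftrightarrow> (\<forall>p \<sigma> a t0 z. 0 < p \<and> p \<le> \<delta> \<and> t0 \<le> a \<and> driven_by h \<sigma> a (a + T) z \<and>
      (\<forall>u\<in>{a..a+T}. \<sigma> u \<in> {1..m}) \<and> (\<forall>u\<in>{a..<a+T}. \<sigma> u = schedule m (\<lambda>_. p) (u - t0)) \<and>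
      z a \<in> sublevel R V \<theta> \<longrightarrow>
      (\<forall>t\<in>{a..a+T}. z t \<in> R \<and> V (z t) \<le> max (V (z a)) (\<epsilon> j) + \<epsilon> j) \<and>
      V (z (a + T)) \<le> max (V (z a) - \<gamma>) (\<epsilon> j))" for j \<delta> \<gamma>
  have "\<exists>\<delta>>0. \<exists>\<gamma>>0. Q j \<delta> \<gamma>" for j unfolding Q_def by (rule window)
  then obtain \<delta> \<gamma> where \<delta>: "\<And>j. \<delta> j > 0" and \<gamma>: "\<And>j. \<gamma> j > 0" and Q: "\<And>j. Q j (\<delta> j) (\<gamma> j)"
    by metis
  note dec = Q[unfolded Q_def, rule_format]
  \<comment> \<open>The minimum over \<open>{..n}\<close> makes \<open>p\<close> antitone and at
    most \<open>\<delta> j\<close> from index \<open>j\<close> on; the terms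
    \<open>1 / Suc j\<close> force it to 0.\<close>
  define p where "p n = Min ((\<lambda>j. min (\<delta> j) (1 / Suc j)) ` {..n})" for n
  have p_pos: "p n > 0" for n using \<delta> by (auto simp: p_def)
  have p_le: "p n \<le> min (\<delta> j) (1 / Suc j)" if "j \<le> n" for j n
    unfolding p_def using that by (intro Min_le) auto
  have "antimono p" unfolding p_def by (intro antimonoI Min_antimono) auto
  moreover have "p \<longlonglongrightarrow> 0"
  proof (rule tendsto_sandwich[OF _ _ tendsto_const LIMSEQ_inverse_real_of_nat])
    show "eventually (\<lambda>n. 0 \<le> p n) sequentially" using p_pos less_imp_le by (intro always_eventually) blast
    show "eventually (\<lambda>n. p n \<le> inverse (Suc n)) sequentially"
      using p_le[OF order_refl] by (intro always_eventually) (auto simp: inverse_eq_divide)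
  qed
  ultimately have \<tau>': "switching_time_function T (\<lambda>s. p (nat \<lfloor>s / T\<rfloor>))"
    using T p_pos by (intro switching_time_function_of_seq) auto
  moreover have "(z \<longlongrightarrow> 0) at_top"
    if x: "x \<in> sublevel R V \<theta>" and \<tau>: "switching_time_function T \<tau>"
      and dom: "dominates \<tau> (\<lambda>s. p (nat \<lfloor>s / T\<rfloor>))"
      and z: "caratheodory_solution t0 (\<lambda>t. h (schedule m \<tau> (t - t0))) x z" for x \<tau> z
  proof -
    define a where "a n = t0 + real n * T" for n
    have a_Suc: "a (Suc n) = a n + T" for n by (simp add: a_def algebra_simps)
    have a_ge: "t0 \<le> a n" for n using T by (simp add: a_def)
    have win: "(\<forall>t\<in>{a n..a n+T}. z t \<in> R \<and> V (z t) \<le> max (V (z (a n))) (\<epsilon> j) + \<epsilon> j) \<and>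
      V (z (a n + T)) \<le> max (V (z (a n)) - \<gamma> j) (\<epsilon> j)"
      if "j \<le> n" "z (a n) \<in> sublevel R V \<theta>" for j n
    proof (rule dec, intro conjI)
      have nT: "0 \<le> n * T" using T by simp
      show "0 < \<tau> (n * T)" using \<tau> nT unfolding switching_time_function_def by blast
      have "\<tau> (n * T) \<le> p (nat \<lfloor>n * T / T\<rfloor>)" using dom nT unfolding dominates_def by blast
      then have "\<tau> (n * T) \<le> p n" using T by simp
      then show "\<tau> (n * T) \<le> \<delta> j" using p_le[OF that(1)] by simp
      show "t0 \<le> a n" by (rule a_ge)
      show "driven_by h (\<lambda>t. schedule m \<tau> (t - t0)) (a n) (a n + T) z"
        unfolding driven_by_def using caratheodory_increment[OF z] a_ge[of n] by auto
      show "\<forall>u\<in>{a n..a n+T}. schedule m \<tau> (u - t0) \<in> {1..m}"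
        using \<tau> a_ge[of n] m by (intro ballI schedule_range) (auto simp: switching_time_function_def)
      \<comment> \<open>Window \<open>n\<close>, counted from 0, is number \<open>Suc n\<close> in
        the definition. At its right end \<open>\<tau>\<close> may jump, hence the half-open
        interval in the comparison of schedules.\<close>
      have "\<tau> constant_on {(real (Suc n) - 1) * T..<real (Suc n) * T}"
        using \<tau> unfolding switching_time_function_def by (metis le_add1 plus_1_eq_Suc)
      then obtain q where q: "\<And>s. s \<in> {n * T..<n * T + T} \<Longrightarrow> \<tau> s = q"
        unfolding constant_on_def by (auto simp: algebra_simps)
      have "\<tau> (u - t0) = \<tau> (n * T)" if "u \<in> {a n..<a n+T}" for u
        using q[of "u - t0"] q[of "n * T"] that T by (auto simp: a_def)
      then show "\<forall>u\<in>{a n..<a n+T}. schedule m \<tau> (u - t0) = schedule m (\<lambda>_. \<tau> (n * T)) (u - t0)"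
        by (simp add: schedule_def)
    qed (fact that)
    have in_\<theta>: "z (a n) \<in> sublevel R V \<theta>" for n
    proof (induction n)
      case 0
      have "z t0 = x" using z by (simp add: caratheodory_solution_def)
      then show ?case using x by (simp add: a_def)
    next
      case (Suc n)
      have "z (a n + T) \<in> R" "V (z (a n + T)) \<le> max (V (z (a n)) - \<gamma> 0) (\<epsilon> 0)"
        using win[OF le0 Suc] T by auto
      moreover have "\<epsilon> 0 \<le> \<theta>" by (simp add: \<epsilon>_def)
      ultimately show ?case using Suc \<gamma>[of 0] by (auto simp: sublevel_def a_Suc)
    qed
    have "eventually (\<lambda>t. z t \<in> R \<and> V (z t) < e) at_top" if e: "e > 0" for e
    proof -
      obtain j where "inverse (Suc j) < e / 2" using reals_Archimedean[of "e / 2"] e by auto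
      \<comment> \<open>The factor 2 is needed because inside a window \<open>V\<close> may exceed
        the bound at its start by another \<open>\<epsilon> j\<close>.\<close>
      then have j: "2 * \<epsilon> j < e"
        using divide_right_mono[of "min 1 \<theta>" 1 "real j + 1"] by (auto simp: \<epsilon>_def inverse_eq_divide add.commute)
      have "eventually (\<lambda>n. V (z (a n)) \<le> \<epsilon> j) sequentially"
        using win in_\<theta> by (intro eventually_le_if_decrease[OF \<gamma>[of j], of j]) (auto simp: a_Suc)
      then obtain N where N: "\<And>n. n \<ge> N \<Longrightarrow> V (z (a n)) \<le> \<epsilon> j"
        unfolding eventually_sequentially by blast
      have "z t \<in> R \<and> V (z t) < e" if t: "t \<ge> a (max N j)" for t
      proof -
        define n where "n = nat \<lfloor>(t - t0) / T\<rfloor>"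
        have "max N j * T \<le> t - t0" using t by (simp add: a_def)
        then have "real (max N j) \<le> (t - t0) / T" using T by (simp add: pos_le_divide_eq)
        then have n: "max N j \<le> n" unfolding n_def by (rule le_nat_floor)
        have "0 \<le> (t - t0) / T" using t a_ge[of "max N j"] T by simp
        then have "real n = of_int \<lfloor>(t - t0) / T\<rfloor>" by (simp add: n_def)
        then have "n \<le> (t - t0) / T" "(t - t0) / T < n + 1" by linarith+
        then have "t \<in> {a n..a n + T}" using T by (auto simp: a_def field_simps)
        then have "z t \<in> R \<and> V (z t) \<le> max (V (z (a n))) (\<epsilon> j) + \<epsilon> j"
          using win[of j n] n in_\<theta> by auto
        then show ?thesis using N[of n] n j by auto
      qed
      then show ?thesis unfolding eventually_at_top_linorder by blast
    qed
    then show ?thesis by (intro tendsto_zero_if_lyapunov[OF K contV V0(2)]) auto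
  qed
  ultimately show ?thesis by blast
qed

section \<open>Openness of the basin and continuity of the fields\<close>

lemma trajectory_shift:
  assumes F: "continuous_on UNIV F" and z: "trajectory F x z" and "s \<ge> 0"
  shows "trajectory F (z s) (\<lambda>t. z (t + s))"
  unfolding caratheodory_solution_def
proof (intro allI impI conjI)
  fix t :: real assume "t \<ge> 0"
  have "continuous_on {0..t + s} z"
    by (rule continuous_on_if_increments[OF caratheodory_increment[OF z]]) auto
  then have "continuous_on {0..t} (\<lambda>u. z (u + s))"
    by (rule continuous_on_compose2) (use \<open>s \<ge> 0\<close> in \<open>auto intro!: continuous_intros\<close>)
  then have "continuous_on {0..t} (\<lambda>u. F (z (u + s)))"
    by (rule continuous_on_compose2[OF F]) auto
  then show "(\<lambda>u. F (z (u + s))) absolutely_integrable_on {0..t}"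
    by (rule absolutely_integrable_continuous_real)
  have "((\<lambda>u. F (z u)) has_integral z (t + s) - z s) {s..t + s}"
    using \<open>s \<ge> 0\<close> \<open>t \<ge> 0\<close> by (intro caratheodory_increment[OF z]) auto
  from has_integral_shift_real_ivl[OF this, of s]
  show "z (t + s) = z s + integral {0..t} (\<lambda>u. F (z (u + s)))"
    by (simp add: integral_unique)
qed

text \<open>\<open>V\<close> is continuous at every point of the basin but tends to infinity at the frontier, so a frontier
  point in the basin would be isolated in it. The trajectory through a nonzero point excludes this.\<close>

lemma open_basin_of_attraction:
  assumes wp: "well_posed 0 (\<lambda>_. F)" and stable: "locally_asymptotically_stable F"
    and lyap: "lyapunov_function F (basin_of_attraction F) V"
  shows "open (basin_of_attraction F)"
proof -
  let ?R = "basin_of_attraction F"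
  have F: "continuous_on UNIV F"
    using wp local_lipschitz_continuous_on[of "{0..}" UNIV "\<lambda>_. F" 0] by (auto simp: well_posed_def)
  have "x \<in> interior ?R" if x: "x \<in> ?R" for x
  proof (cases "x = 0")
    case True
    \<comment> \<open>Local attractivity puts a whole ball into the basin, since a trajectory starts
      at every point.\<close>
    obtain \<delta> where \<delta>: "\<delta> > 0" "\<And>x0 z. norm x0 < \<delta> \<Longrightarrow> trajectory F x0 z \<Longrightarrow> (z \<longlongrightarrow> 0) at_top"
      using stable unfolding locally_asymptotically_stable_def by blast
    have "y \<in> ?R" if "y \<in> ball 0 \<delta>" for y
    proof -
      obtain z where "trajectory F y z" using wp unfolding well_posed_def by blast
      then show ?thesis using \<delta>(2)[of y z] that unfolding basin_of_attraction_def by auto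
    qed
    then show ?thesis using \<delta>(1) True by (intro interiorI[of "ball 0 \<delta>"]) auto
  next
    case False
    obtain z where z: "trajectory F x z" "(z \<longlongrightarrow> 0) at_top"
      using x unfolding basin_of_attraction_def by blast
    have z0: "z 0 = x" using z by (simp add: caratheodory_solution_def)
    let ?C = "z ` {0..}"
    have "((\<lambda>t. z (t + s)) \<longlongrightarrow> 0) at_top" for s
      by (rule filterlim_compose[OF z(2)])
        (intro filterlim_tendsto_add_at_top[OF tendsto_const] filterlim_ident | subst add.commute)+
    \<comment> \<open>Time shifts of the trajectory are trajectories that converge to 0 too, so the
      whole orbit lies in the basin.\<close>
    then have "?C \<subseteq> ?R"
      using trajectory_shift[OF F z(1)] unfolding basin_of_attraction_def by fastforce
    have cont: "continuous_on {0..t} z" for t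
      by (rule continuous_on_if_increments[OF caratheodory_increment[OF z(1)]]) auto
    have "continuous_on {0..} z"
      unfolding continuous_on_def
    proof
      fix t :: real assume "t \<in> {0..}"
      moreover have "at t within {0..} = at t within {0..t + 1}"
        by (rule at_within_nhd[of _ "{..<t + 1}"]) auto
      ultimately show "(z \<longlongrightarrow> z t) (at t within {0..})"
        using cont[of "t + 1"] by (simp add: continuous_on_def)
    qed
    then have "connected ?C" by (intro connected_continuous_image) auto
    \<comment> \<open>A constant trajectory would converge to \<open>x\<close> as well as to 0.
      Having more than one point, the connected orbit has no isolated point.\<close>
    moreover have "\<nexists>y. ?C = {y}"
    proof safe
      fix y assume y: "?C = {y}"
      then have "z t = x" if "t \<ge> 0" for t using that z0 by (metis atLeast_iff imageI order_refl singletonD)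
      then have "eventually (\<lambda>t. z t = x) at_top" unfolding eventually_at_top_linorder by blast
      then have "(z \<longlongrightarrow> x) at_top" by (rule tendsto_eventually)
      then show False using tendsto_unique[OF _ z(2)] False by auto
    qed
    ultimately have "x islimpt ?C" using z0 by (intro connected_imp_perfect) force+
    then have "x islimpt ?R" using \<open>?C \<subseteq> ?R\<close> by (rule islimpt_subset)
    then have nontriv: "at x within ?R \<noteq> bot" by (simp add: trivial_limit_within)
    have "isCont V x"
      using lyap x unfolding lyapunov_function_def gderiv_def by (meson has_derivative_continuous)
    then have "(V \<longlongrightarrow> V x) (at x within ?R)" by (metis continuous_at_imp_continuous_at_within continuous_within)
    moreover have "x \<in> frontier ?R \<Longrightarrow> filterlim V at_top (at x within ?R)"
      using lyap unfolding lyapunov_function_def by blast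
    ultimately have "x \<notin> frontier ?R"
      using not_tendsto_and_filterlim_at_infinity[OF nontriv] filterlim_at_top_imp_at_infinity by blast
    then show ?thesis using x closure_subset by (auto simp: frontier_def)
  qed
  then have "interior ?R = ?R" using interior_subset by blast
  then show ?thesis by (simp add: interior_eq)
qed

text \<open>A scheduled system is locally Lipschitz in the state at every time, so it suffices to
  exhibit one switching-time function and one time at which channel \<open>k\<close> is
  active.\<close>

lemma continuous_on_scheduled:
  assumes m: "m \<ge> 1" and "T > 0" and k: "k \<in> {1..m}"
    and wp: "\<And>\<tau>. switching_time_function T \<tau> \<Longrightarrow> well_posed t0 (\<lambda>t. h (schedule m \<tau> (t - t0)))"
  shows "continuous_on UNIV (h k)"
proof -
  \<comment> \<open>With \<open>p 0 = T / (2 * m)\<close> the first cycle ends at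
    \<open>T / 2\<close>, well inside the first window.\<close>
  define p where "p n = T / (2 * m) * inverse (real (Suc n))" for n
  have p_pos: "p n > 0" for n using m \<open>T > 0\<close> by (simp add: p_def)
  have "antimono p"
    unfolding p_def using m \<open>T > 0\<close> by (intro antimonoI mult_left_mono le_imp_inverse_le) auto
  moreover have "p \<longlonglongrightarrow> 0"
    unfolding p_def using tendsto_mult_right_zero[OF LIMSEQ_inverse_real_of_nat] by blast
  ultimately have \<tau>: "switching_time_function T (\<lambda>s. p (nat \<lfloor>s / T\<rfloor>))"
    using \<open>T > 0\<close> p_pos by (intro switching_time_function_of_seq) auto
  \<comment> \<open>This is the start of slot \<open>k\<close> of the first cycle.\<close>
  define s where "s = (real k - 1) * p 0"
  have s: "0 \<le> s" using k p_pos[of 0] by (simp add: s_def)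
  have "s \<le> m * p 0" unfolding s_def using k p_pos[of 0] by (intro mult_right_mono) auto
  also have "\<dots> < T" using m \<open>T > 0\<close> by (simp add: p_def)
  finally have "\<lfloor>s / T\<rfloor> = 0" using s \<open>T > 0\<close> by (simp add: floor_eq_iff)
  then have "schedule m (\<lambda>s. p (nat \<lfloor>s / T\<rfloor>)) s = k"
    using k p_pos[of 0] by (intro schedule_eq[where p="p 0" and i=0]) (auto simp: s_def)
  then show ?thesis
    using wp[OF \<tau>] s local_lipschitz_continuous_on[of "{t0..}" UNIV _ "t0 + s"]
    unfolding well_posed_def by fastforce
qed

section \<open>Application to the scheduled closed-loop system\<close>

theorem theorem2p11:
  fixes m :: nat
    and f :: "real ^ 'd \<Rightarrow> real ^ 'd"
    and g :: "nat \<Rightarrow> real ^ 'd \<Rightarrow> real ^ 'd"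
    and \<kappa> :: "nat \<Rightarrow> real ^ 'd \<Rightarrow> real"
    and V :: "real ^ 'd \<Rightarrow> real"
    and t0 T :: real
  defines "F \<equiv> nominal_field m f g \<kappa>"
  defines "R_cl \<equiv> basin_of_attraction F"
  assumes "m \<ge> 1"
    and "C1_on UNIV f"
    and "\<forall>k\<in>{1..m}. C1_on UNIV (g k)"
    and "hyperbolic_equilibrium F 0"
    and "locally_asymptotically_stable F"
    and "\<exists>U. open U \<and> 0 \<in> U \<and> C2_on U F"
    and "f 0 = 0"
    and "\<forall>k\<in>{1..m}. \<kappa> k 0 = 0"
    and "t0 \<ge> 0"
    and "T > 0"
    and "well_posed 0 (\<lambda>_. F)"
    and "\<forall>\<tau>. switching_time_function T \<tau> \<longrightarrow> well_posed t0 (scheduled_field m f g \<kappa> t0 \<tau>)"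
    and "lyapunov_function F R_cl V"
  shows "\<forall>\<theta>>0. \<exists>\<tau>'. switching_time_function T \<tau>' \<and>
           (\<forall>x\<in>sublevel R_cl V \<theta>. \<forall>\<tau>. switching_time_function T \<tau> \<and> dominates \<tau> \<tau>' \<longrightarrow>
              (\<forall>z. caratheodory_solution t0 (scheduled_field m f g \<kappa> t0 \<tau>) x z \<longrightarrow>
                   (z \<longlongrightarrow> 0) at_top))"
proof (intro allI impI)
  fix \<theta> :: real assume \<theta>: "\<theta> > 0"
  define h where "h k x = f x + (real m * \<kappa> k x) *\<^sub>R g k x" for k x
  have field: "scheduled_field m f g \<kappa> t0 \<tau> = (\<lambda>t. h (schedule m \<tau> (t - t0)))" for \<tau>
    by (simp add: fun_eq_iff scheduled_field_def h_def Let_def)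
  \<comment> \<open>Each channel is active for a fraction \<open>1 / m\<close> of a cycle, for which
    the factor \<open>m\<close> in the scheduled field compensates: the average of the
    \<open>h k\<close> is \<open>F\<close>, and \<open>V\<close> decreases along their sum.\<close>
  have sum_h: "(\<Sum>k=1..m. h k x) = real m *\<^sub>R F x" for x
    by (simp add: h_def F_def nominal_field_def sum.distrib scaleR_sum_right scaleR_add_right
        sum_constant_scaleR del: sum_constant)
  have h: "continuous_on R_cl (h k)" if "k \<in> {1..m}" for k
    using continuous_on_scheduled[OF assms(3) \<open>T > 0\<close> that, of t0 h] assms(14)
    unfolding field by (blast intro: continuous_on_subset)
  obtain G where G: "\<And>x. x \<in> R_cl \<Longrightarrow> GDERIV V x :> G x" "continuous_on R_cl G"
    "\<And>x. x \<in> R_cl - {0} \<Longrightarrow> G x \<bullet> F x < 0"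
    using assms(15) unfolding lyapunov_function_def by blast
  have V: "V 0 = 0" "\<And>x. x \<in> R_cl - {0} \<Longrightarrow> V x > 0" "\<And>\<theta>. \<theta> > 0 \<Longrightarrow> compact (sublevel R_cl V \<theta>)"
    using assms(15) unfolding lyapunov_function_def by blast+
  have "open R_cl"
    unfolding R_cl_def using assms(7,13,15) by (intro open_basin_of_attraction[where V=V]) (auto simp: R_cl_def)
  moreover have "G x \<bullet> (\<Sum>k=1..m. h k x) < 0" if "x \<in> R_cl" "x \<noteq> 0" for x
    using G(3)[of x] that assms(3) unfolding sum_h by (simp add: mult_pos_neg)
  ultimately show "\<exists>\<tau>'. switching_time_function T \<tau>' \<and>
           (\<forall>x\<in>sublevel R_cl V \<theta>. \<forall>\<tau>. switching_time_function T \<tau> \<and> dominates \<tau> \<tau>' \<longrightarrow>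
              (\<forall>z. caratheodory_solution t0 (scheduled_field m f g \<kappa> t0 \<tau>) x z \<longrightarrow>
                   (z \<longlongrightarrow> 0) at_top))"
    unfolding field using V G h \<theta>
    by (intro scheduled_convergence[where V=V and G=G and h=h] assms(3) \<open>T > 0\<close>) auto
qed

end
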